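(* Let $\lambda>0$ and $r>0$ be fixed, and let $m\ge 1$ and $k\ge 0$ be integers. Let $P^n_m(1,k)$ be the probability that the exponential random geometric graph $G_n(\lambda,r)$ has exactly $k$ components of size $m$, and let $\theta_s=\lim_{n\to\infty}\theta_{n,n-s}$, where $\theta_{n,j}$ is the probability that the $j$-th ordered node $X_{(j)}$ is the last node of the first component of $G_n(\lambda,r)$. Then the limiting distribution of the number of components of size $m$ is given by $$\lim_{n\to\infty}P^n_m(1,k)=\sum_{s=mk}^{\infty}\theta_s\,P^s_m(1,k).$$
   Context: $G_n(\lambda,r)$ is the random graph with vertex set $\{X_1,\dots,X_n\}$, where $X_1,\dots,X_n$ are i.i.d. exponential random variables with mean $\lambda^{-1}$, and with an edge between $X_i$ and $X_j$ ($i\neq j$) if and only if $|X_i-X_j|\le r$. $X_{(1)}\le\dots\le X_{(n)}$ are the order statistics; the first component is the connected component containing $X_{(1)}$, and its last node is its largest element. The size of a component is its number of nodes. For the graph with $0$ nodes, $P^0_m(1,0)=1$. *)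

theory Defs
  imports "HOL-Probability.Probability"
begin

definition exponential_sample ::
  "real \<Rightarrow> nat \<Rightarrow> 'a measure \<Rightarrow> (nat \<Rightarrow> 'a \<Rightarrow> real) \<Rightarrow> bool" where
  "exponential_sample l n M X \<longleftrightarrow>
     prob_space M \<and>
     prob_space.indep_vars M (\<lambda>_. borel) X {1..n} \<and>
     (\<forall>i\<in>{1..n}. distributed M lborel (X i) (exponential_density l))"

text \<open>
  The nodes of the geometric graph on the points \<open>x 1, \<dots>, x n\<close> are the indices
  \<open>1, \<dots>, n\<close>, so points that coincide still count as distinct nodes.
\<close>

definition geom_edges :: "nat \<Rightarrow> real \<Rightarrow> (nat \<Rightarrow> real) \<Rightarrow> (nat \<times> nat) set" where
  "geom_edges n r x =
     {(i, j). i \<in> {1..n} \<and> j \<in> {1..n} \<and> i \<noteq> j \<and> \<bar>x i - x j\<bar> \<le> r}"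

text \<open>
  The edge relation is symmetric and lives on \<open>{1..n}\<close>, so the classes below are
  the connected components, and they are subsets of \<open>{1..n}\<close>.
\<close>

definition geom_components :: "nat \<Rightarrow> real \<Rightarrow> (nat \<Rightarrow> real) \<Rightarrow> nat set set" where
  "geom_components n r x = {1..n} // (geom_edges n r x)\<^sup>*"

text \<open>Order statistics are numbered from 1, whereas list positions start at 0.\<close>

definition order_stat :: "nat \<Rightarrow> (nat \<Rightarrow> real) \<Rightarrow> nat \<Rightarrow> real" where
  "order_stat n x j = sort (map x [1..<Suc n]) ! (j - 1)"

definition last_node_of_first :: "nat \<Rightarrow> real \<Rightarrow> (nat \<Rightarrow> real) \<Rightarrow> nat \<Rightarrow> bool" where
  "last_node_of_first n r x j \<longleftrightarrow>
     j \<in> {1..n} \<and>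
     (\<exists>C\<in>geom_components n r x.
        order_stat n x 1 \<in> x ` C \<and> Max (x ` C) = order_stat n x j)"

definition component_count_prob ::
  "'a measure \<Rightarrow> (nat \<Rightarrow> 'a \<Rightarrow> real) \<Rightarrow> real \<Rightarrow> nat \<Rightarrow> nat \<Rightarrow> nat \<Rightarrow> real" where
  "component_count_prob M X r n m k =
     measure M {\<omega> \<in> space M.
       card {C \<in> geom_components n r (\<lambda>i. X i \<omega>). card C = m} = k}"

definition last_node_prob ::
  "'a measure \<Rightarrow> (nat \<Rightarrow> 'a \<Rightarrow> real) \<Rightarrow> real \<Rightarrow> nat \<Rightarrow> nat \<Rightarrow> real" where
  "last_node_prob M X r n j =
     measure M {\<omega> \<in> space M. last_node_of_first n r (\<lambda>i. X i \<omega>) j}"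

text \<open>
  The graph on \<open>n\<close> nodes may live on its own probability space \<open>M n\<close>, with points
  \<open>X n 1, \<dots>, X n n\<close>.  The subtraction \<open>n - s\<close> is truncated only for \<open>n < s\<close>,
  which does not affect the limit.
\<close>

definition limit_last_node_prob ::
  "(nat \<Rightarrow> 'a measure) \<Rightarrow> (nat \<Rightarrow> nat \<Rightarrow> 'a \<Rightarrow> real) \<Rightarrow> real \<Rightarrow> nat \<Rightarrow> real" where
  "limit_last_node_prob M X r s = lim (\<lambda>n. last_node_prob (M n) (X n) r n (n - s))"

end

theory Submission
  imports Defs
begin

text \<open>
  The number of components and the end of the first component depend only on which gaps
  between consecutive order statistics are longer than \<open>r\<close>. By the memoryless property of the
  exponential distribution these gaps are independent, and the gap with \<open>i\<close> points behind it is
  exponential with rate \<open>i * l\<close>; it is longer than \<open>r\<close> with probability \<open>q ^ i\<close>, where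
  \<open>q = exp (- (l * r))\<close>. The rate depends on the points behind the gap only, so the points behind
  the first component look like a fresh sample of smaller size. Conditioning on the number \<open>s\<close>
  of these points gives a renewal equation for the law of the number of components of size
  \<open>m\<close> (\<open>count_law_renewal\<close>): a sum over \<open>s < n\<close> of the probability that \<open>s\<close> points are
  left, times the law for \<open>s\<close> points, apart from the term in which the first component has
  size \<open>m\<close> itself. This exceptional term sits at \<open>s = n - m\<close> and moves off to infinity with \<open>n\<close>.
  The probability that \<open>s\<close> points are left is at most \<open>q ^ s\<close> and decreases in \<open>n\<close>, so
  dominated convergence gives the limit (\<open>count_law_tendsto\<close>).

  The independence of the gaps is obtained by a single induction
  (\<open>nn_integral_ordered_gap_event\<close>), which computes by iterated integration the probability that
  the points come in a prescribed order and with a prescribed gap pattern. Summing over all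
  orders gives the law of the pattern of the sorted sample (\<open>prob_sorted_sample\<close>). The
  translation between graph and gap pattern is deterministic: the components are the maximal
  runs of sorted nodes without a long gap (\<open>geom_components_eq_clusters\<close>).
\<close>

section \<open>Random gap patterns\<close>

text \<open>
  The expectation of \<open>f\<close> over the gap pattern of \<open>n\<close> ordered exponential points, the origin
  being put in front of them. An entry is \<open>True\<close> if the gap is longer than \<open>r\<close>. A gap
  with \<open>i\<close> nodes behind it is the minimum of \<open>i\<close> residual lifetimes, hence exponential with rate
  \<open>i * l\<close>, and it exceeds \<open>r\<close> with probability \<open>q ^ i\<close> for \<open>q = exp (- (l * r))\<close>. The head of
  the list is the gap with most nodes behind it, so the tail of a pattern of length \<open>Suc n\<close>
  is distributed as a pattern of length \<open>n\<close>.
\<close>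

primrec gap_mean :: "real \<Rightarrow> nat \<Rightarrow> (bool list \<Rightarrow> real) \<Rightarrow> real" where
  "gap_mean q 0 f = f []"
| "gap_mean q (Suc n) f =
     q ^ Suc n * gap_mean q n (\<lambda>bs. f (True # bs)) +
     (1 - q ^ Suc n) * gap_mean q n (\<lambda>bs. f (False # bs))"

lemma gap_mean_cong:
  "(\<And>bs. length bs = n \<Longrightarrow> f bs = g bs) \<Longrightarrow> gap_mean q n f = gap_mean q n g"
proof (induction n arbitrary: f g)
  case (Suc n)
  have "gap_mean q n (\<lambda>bs. f (b # bs)) = gap_mean q n (\<lambda>bs. g (b # bs))" for b
    by (rule Suc.IH) (simp add: Suc.prems)
  then show ?case by simp
qed simp

lemma gap_mean_const [simp]: "gap_mean q n (\<lambda>_. c) = c"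
  by (induction n) (auto simp: algebra_simps)

lemma gap_mean_mono:
  assumes "0 \<le> q" "q \<le> 1"
  shows "(\<And>bs. length bs = n \<Longrightarrow> f bs \<le> g bs) \<Longrightarrow> gap_mean q n f \<le> gap_mean q n g"
proof (induction n arbitrary: f g)
  case (Suc n)
  have "gap_mean q n (\<lambda>bs. f (b # bs)) \<le> gap_mean q n (\<lambda>bs. g (b # bs))" for b
    by (rule Suc.IH) (simp add: Suc.prems)
  then show ?case
    using assms power_le_one[of q "Suc n"] by (auto intro!: add_mono mult_left_mono simp del: power_Suc)
qed simp

lemma gap_mean_nonneg:
  assumes "0 \<le> q" "q \<le> 1" "\<And>bs. 0 \<le> f bs"
  shows "0 \<le> gap_mean q n f"
  using gap_mean_mono[OF assms(1,2), of n "\<lambda>_. 0" f] assms(3) by simp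

text \<open>
  The probability that the gaps with \<open>n - 1, \<dots>, s + 1\<close> nodes behind them are short and the one
  with \<open>s\<close> nodes behind it is long. For \<open>s = 0\<close> the factor \<open>q ^ 0 = 1\<close> expresses that the last
  point always ends a component.
\<close>

definition nodes_left_prob :: "real \<Rightarrow> nat \<Rightarrow> nat \<Rightarrow> real" where
  "nodes_left_prob q n s = (if s < n then q ^ s * (\<Prod>i\<in>{s<..<n}. 1 - q ^ i) else 0)"

lemma nodes_left_prob_Suc:
  "s < n \<Longrightarrow> nodes_left_prob q (Suc n) s = (1 - q ^ n) * nodes_left_prob q n s"
proof -
  assume "s < n"
  then have "{s<..<Suc n} = insert n {s<..<n}" by auto
  with \<open>s < n\<close> show ?thesis by (simp add: nodes_left_prob_def)
qed

lemma nodes_left_prob_last [simp]: "nodes_left_prob q (Suc n) n = q ^ n"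
proof -
  have "{n<..<Suc n} = {}" by auto
  then show ?thesis by (simp add: nodes_left_prob_def)
qed

lemma nodes_left_prob_bounds:
  assumes "0 \<le> q" "q \<le> 1"
  shows "0 \<le> nodes_left_prob q n s" "nodes_left_prob q n s \<le> q ^ s"
proof -
  have "0 \<le> (\<Prod>i\<in>{s<..<n}. 1 - q ^ i) \<and> (\<Prod>i\<in>{s<..<n}. 1 - q ^ i) \<le> 1"
    using assms by (auto intro!: prod_nonneg prod_le_1 simp: power_le_one)
  then show "0 \<le> nodes_left_prob q n s" "nodes_left_prob q n s \<le> q ^ s"
    using assms by (auto simp: nodes_left_prob_def mult_left_le)
qed

text \<open>
  Each additional point in the sample multiplies the probability by a factor in \<open>[0, 1]\<close>, so
  the sequence decreases from \<open>n = s + 1\<close> on.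
\<close>

lemma nodes_left_prob_convergent:
  assumes "0 \<le> q" "q \<le> 1"
  shows "convergent (\<lambda>n. nodes_left_prob q n s)"
proof -
  have "decseq (\<lambda>n. nodes_left_prob q (n + Suc s) s)"
  proof (rule decseq_SucI)
    fix n
    have "(1 - q ^ (n + Suc s)) * nodes_left_prob q (n + Suc s) s
      \<le> 1 * nodes_left_prob q (n + Suc s) s"
      using assms by (intro mult_right_mono nodes_left_prob_bounds) auto
    then show "nodes_left_prob q (Suc n + Suc s) s \<le> nodes_left_prob q (n + Suc s) s"
      using nodes_left_prob_Suc[of s "n + Suc s" q] by simp
  qed
  moreover have "Bseq (\<lambda>n. nodes_left_prob q (n + Suc s) s)"
    using nodes_left_prob_bounds[OF assms] assms by (intro BseqI'[of _ "q ^ s"]) auto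
  ultimately have "convergent (\<lambda>n. nodes_left_prob q (n + Suc s) s)"
    by (intro Bseq_monoseq_convergent decseq_imp_monoseq)
  then show ?thesis by (subst (asm) convergent_ignore_initial_segment)
qed

text \<open>
  The renewal equation: \<open>dropWhile Not (tl bs)\<close> is the pattern of the points behind the first
  component, its head being the long gap that ends that component. If \<open>H\<close> ignores this head,
  then the head may be taken as random again, so that what follows the first component has
  the law of a fresh, smaller sample.
\<close>

lemma gap_mean_renewal:
  assumes H: "\<And>b c bs. H (b # bs) = H (c # bs)"
  shows "gap_mean q (Suc n) (\<lambda>bs. H (dropWhile Not (tl bs))) =
    (\<Sum>s<Suc n. nodes_left_prob q (Suc n) s * gap_mean q s H)"
proof -
  have "gap_mean q n (\<lambda>bs. H (dropWhile Not bs)) =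
    (\<Sum>s<Suc n. nodes_left_prob q (Suc n) s * gap_mean q s H)"
  proof (induction n)
    case 0
    show ?case by simp
  next
    case (Suc n)
    \<comment> \<open>As \<open>H\<close> ignores the head, averaging over it is the same as setting it to \<open>True\<close>.\<close>
    have "gap_mean q (Suc n) H = gap_mean q n (\<lambda>bs. H (True # bs))"
      by (simp add: H[of False _ True] algebra_simps del: power_Suc)
    moreover have "gap_mean q (Suc n) (\<lambda>bs. H (dropWhile Not bs)) =
        q ^ Suc n * gap_mean q n (\<lambda>bs. H (True # bs)) +
        (1 - q ^ Suc n) * gap_mean q n (\<lambda>bs. H (dropWhile Not bs))"
      by simp
    moreover have "(1 - q ^ Suc n) * gap_mean q n (\<lambda>bs. H (dropWhile Not bs)) =
        (\<Sum>s<Suc n. nodes_left_prob q (Suc (Suc n)) s * gap_mean q s H)"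
      unfolding Suc.IH sum_distrib_left
      by (intro sum.cong refl) (simp add: nodes_left_prob_Suc[of _ "Suc n"] del: power_Suc)
    ultimately show ?case
      by (subst sum.lessThan_Suc) (simp del: power_Suc sum.lessThan_Suc gap_mean.simps)
  qed
  then show ?thesis
    by (simp add: algebra_simps)
qed

section \<open>Gaps of ordered exponential points\<close>

fun gaps :: "real \<Rightarrow> real \<Rightarrow> real list \<Rightarrow> bool list" where
  "gaps r a [] = []"
| "gaps r a (y # ys) = (r < y - a) # gaps r y ys"

lemma length_gaps [simp]: "length (gaps r a ys) = length ys"
  by (induction ys arbitrary: a) auto

lemma measurable_gaps:
  assumes "A \<in> borel_measurable (PiM I (\<lambda>_. borel))" "set ns \<subseteq> I"
  shows "(\<lambda>x. gaps r (A x) (map x ns)) \<in> PiM I (\<lambda>_. borel :: real measure) \<rightarrow>\<^sub>M count_space UNIV"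
  using assms
proof (induction ns arbitrary: A)
  case (Cons i ns)
  have [measurable]: "A \<in> borel_measurable (PiM I (\<lambda>_. borel))"
    and [measurable]: "(\<lambda>x. x i) \<in> borel_measurable (PiM I (\<lambda>_. borel :: real measure))"
    using Cons.prems by (auto intro: measurable_component_singleton)
  have [measurable]: "(\<lambda>x. gaps r (x i) (map x ns)) \<in> PiM I (\<lambda>_. borel :: real measure) \<rightarrow>\<^sub>M count_space UNIV"
    using Cons by (intro Cons.IH) auto
  have "Measurable.pred (PiM I (\<lambda>_. borel :: real measure)) (\<lambda>x. r < x i - A x)" by measurable
  then have "(\<lambda>x. (r < x i - A x) # gaps r (x i) (map x ns)) \<in> PiM I (\<lambda>_. borel) \<rightarrow>\<^sub>M count_space UNIV"
    by measurable
  then show ?case by simp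
qed simp

lemma measurable_sorted_wrt_map:
  assumes "set ns \<subseteq> I" and "\<And>i j. i \<in> I \<Longrightarrow> j \<in> I \<Longrightarrow> Measurable.pred (PiM I N) (\<lambda>x. P (x i) (x j))"
  shows "Measurable.pred (PiM I N) (\<lambda>x. sorted_wrt P (map x ns))"
  using assms(1)
proof (induction ns)
  case (Cons i ns)
  have [measurable]: "Measurable.pred (PiM I N) (\<lambda>x. sorted_wrt P (map x ns))"
    using Cons by auto
  have [measurable]: "Measurable.pred (PiM I N) (\<lambda>x. \<forall>j\<in>set ns. P (x i) (x j))"
    using Cons.prems assms(2) by (intro pred_intros_finite) auto
  show ?case by simp
qed simp

text \<open>
  Integrating the probability \<open>exp (- n l y)\<close> that \<open>n\<close> further points lie beyond \<open>y\<close> against the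
  position \<open>y\<close> of one point raises the rate to \<open>(n + 1) l\<close>. The left end point is removed from
  \<open>S\<close> because strict orderings lead to half-open intervals, whereas antiderivatives are
  evaluated on closed ones.
\<close>

lemma nn_integral_exponential_tilt:
  fixes a l c :: real
  assumes l: "l > 0" and a: "0 \<le> a" and c: "0 \<le> c" and S: "S \<in> sets borel" "S \<subseteq> {a..}"
  shows "(\<integral>\<^sup>+y. ennreal (c * exp (- (real n * l * y))) * indicator (S - {a}) y
      \<partial>density lborel (exponential_density l))
    = (\<integral>\<^sup>+y. ennreal (c * l * exp (- (real (Suc n) * l * y))) * indicator S y \<partial>lborel)"
proof -
  let ?f = "\<lambda>y. c * l * exp (- (real (Suc n) * l * y))"
  have "(\<integral>\<^sup>+y. ennreal (c * exp (- (real n * l * y))) * indicator (S - {a}) y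
      \<partial>density lborel (exponential_density l))
    = (\<integral>\<^sup>+y. ennreal (exponential_density l y) *
        (ennreal (c * exp (- (real n * l * y))) * indicator (S - {a}) y) \<partial>lborel)"
    using S(1) by (intro nn_integral_density) auto
  also have "\<dots> = (\<integral>\<^sup>+y. ennreal (?f y) * indicator S y \<partial>lborel)"
  proof (rule nn_integral_cong_AE)
    show "AE y in lborel. ennreal (exponential_density l y) *
      (ennreal (c * exp (- (real n * l * y))) * indicator (S - {a}) y) = ennreal (?f y) * indicator S y"
      using AE_lborel_singleton[of a]
    proof eventually_elim
      case (elim y)
      have "exponential_density l y * (c * exp (- (real n * l * y))) = ?f y" if "a \<le> y"
        using that a by (simp add: exponential_density_def exp_add[symmetric] algebra_simps)
      moreover have "a \<le> y" if "y \<in> S" using that S(2) by auto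
      ultimately show ?case using elim l c
        by (auto simp: indicator_def ennreal_mult'[symmetric] exponential_density_nonneg)
    qed
  qed
  finally show ?thesis .
qed

lemma nn_integral_exponential_Ioc:
  fixes a b l c :: real
  assumes l: "l > 0" and a: "0 \<le> a" "a \<le> b" and c: "0 \<le> c"
  shows "(\<integral>\<^sup>+y. ennreal (c * exp (- (real n * l * y))) * indicator {a<..b} y
      \<partial>density lborel (exponential_density l))
    = ennreal (c / Suc n * (exp (- (real (Suc n) * l * a)) - exp (- (real (Suc n) * l * b))))"
proof -
  let ?F = "\<lambda>y. - c / Suc n * exp (- (real (Suc n) * l * y))"
  have "(\<integral>\<^sup>+y. ennreal (c * exp (- (real n * l * y))) * indicator {a<..b} y
      \<partial>density lborel (exponential_density l))
    = (\<integral>\<^sup>+y. ennreal (c * l * exp (- (real (Suc n) * l * y))) * indicator {a..b} y \<partial>lborel)"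
  proof -
    have "{a..b} - {a} = {a<..b}" by auto
    then show ?thesis using nn_integral_exponential_tilt[OF l a(1) c, of "{a..b}" n] by auto
  qed
  also have "\<dots> = ?F b - ?F a"
    using a l c by (intro nn_integral_FTC_Icc) (auto intro!: derivative_eq_intros)
  also have "?F b - ?F a = c / Suc n * (exp (- (real (Suc n) * l * a)) - exp (- (real (Suc n) * l * b)))"
    by (simp add: algebra_simps)
  finally show ?thesis .
qed

lemma nn_integral_exponential_greaterThan:
  fixes a l c :: real
  assumes l: "l > 0" and a: "0 \<le> a" and c: "0 \<le> c"
  shows "(\<integral>\<^sup>+y. ennreal (c * exp (- (real n * l * y))) * indicator {a<..} y
      \<partial>density lborel (exponential_density l))
    = ennreal (c / Suc n * exp (- (real (Suc n) * l * a)))"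
proof -
  let ?F = "\<lambda>y. - c / Suc n * exp (- (real (Suc n) * l * y))"
  have "(\<integral>\<^sup>+y. ennreal (c * exp (- (real n * l * y))) * indicator {a<..} y
      \<partial>density lborel (exponential_density l))
    = (\<integral>\<^sup>+y. ennreal (c * l * exp (- (real (Suc n) * l * y))) * indicator {a..} y \<partial>lborel)"
  proof -
    have "{a..} - {a} = {a<..}" by auto
    then show ?thesis using nn_integral_exponential_tilt[OF l a c, of "{a..}" n] by auto
  qed
  also have "\<dots> = 0 - ?F a"
  proof (intro nn_integral_FTC_atLeast)
    have "LIM y at_top. real (Suc n) * l * y :> at_top"
      using l by (intro filterlim_tendsto_pos_mult_at_top[OF tendsto_const] filterlim_ident) auto
    then have "((\<lambda>y. exp (- (real (Suc n) * l * y))) \<longlongrightarrow> 0) at_top"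
      by (intro filterlim_compose[OF exp_at_bot]) (simp only: filterlim_uminus_at_bot minus_minus)
    from tendsto_mult_left[OF this, of "- c / Suc n"] show "(?F \<longlongrightarrow> 0) at_top" by simp
  qed (use a l c in \<open>auto intro!: derivative_eq_intros\<close>)
  finally show ?thesis by simp
qed

definition ordered_gap_event :: "real \<Rightarrow> (bool list \<Rightarrow> bool) \<Rightarrow> real \<Rightarrow> real list \<Rightarrow> bool" where
  "ordered_gap_event r R a ys \<longleftrightarrow> sorted_wrt (<) (a # ys) \<and> R (gaps r a ys)"

lemma ordered_gap_event_Cons:
  "ordered_gap_event r R a (y # ys) \<longleftrightarrow>
     a < y \<and> ordered_gap_event r (\<lambda>bs. R ((r < y - a) # bs)) y ys"
  by (auto simp: ordered_gap_event_def)

lemma measurable_ordered_gap_event: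
  assumes "set ns \<subseteq> I"
  shows "Measurable.pred (PiM I (\<lambda>_. borel :: real measure)) (\<lambda>x. ordered_gap_event r R a (map x ns))"
proof -
  have [measurable]: "(\<lambda>x. gaps r a (map x ns)) \<in> PiM I (\<lambda>_. borel :: real measure) \<rightarrow>\<^sub>M count_space UNIV"
    using assms by (intro measurable_gaps) auto
  have [measurable]: "(\<lambda>x. x i) \<in> borel_measurable (PiM I (\<lambda>_. borel :: real measure))" if "i \<in> I" for i
    using that by (rule measurable_component_singleton)
  have [measurable]: "Measurable.pred (PiM I (\<lambda>_. borel :: real measure)) (\<lambda>x. sorted_wrt (<) (map x ns))"
    using assms by (intro measurable_sorted_wrt_map) measurable
  have [measurable]: "Measurable.pred (PiM I (\<lambda>_. borel :: real measure)) (\<lambda>x. \<forall>i\<in>set ns. a < x i)"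
    using assms by (intro pred_intros_finite) auto
  have [measurable]: "Measurable.pred (count_space UNIV) R" by simp
  show ?thesis unfolding ordered_gap_event_def by simp measurable
qed

text \<open>
  The memoryless property in integrated form: independent points lie in the prescribed order
  beyond \<open>a\<close> with probability \<open>exp (- n l a) / fact n\<close>, and their gap pattern is then
  distributed according to \<^const>\<open>gap_mean\<close>, whatever \<open>a\<close> is. Having \<open>a\<close> as a
  parameter makes the induction work: once the first point is integrated last, it becomes
  the starting point of the remaining ones.
\<close>

lemma nn_integral_ordered_gap_event:
  fixes l r a :: real
  assumes l: "l > 0" and r: "r > 0" and a: "0 \<le> a" and "distinct ns"
  defines "E \<equiv> density lborel (exponential_density l)"
  shows "(\<integral>\<^sup>+x. indicator {x. ordered_gap_event r R a (map x ns)} x \<partial>PiM (set ns) (\<lambda>_. E)) =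
    ennreal (gap_mean (exp (- (l * r))) (length ns) (\<lambda>bs. of_bool (R bs)) / fact (length ns)
      * exp (- (real (length ns) * l * a)))"
  using a \<open>distinct ns\<close>
proof (induction ns arbitrary: R a)
  case Nil
  show ?case
    by (simp add: ordered_gap_event_def indicator_def space_PiM_empty emeasure_PiM_empty)
next
  case (Cons i ns)
  have sets_E: "sets E = sets borel" by (simp add: E_def)
  interpret product_sigma_finite "\<lambda>_::'a. E"
    unfolding E_def product_sigma_finite_def
    using prob_space_exponential_density[OF l] prob_space_imp_sigma_finite by blast
  define n where "n = length ns"
  define q where "q = exp (- (l * r))"
  define g where "g b = gap_mean q n (\<lambda>bs. of_bool (R (b # bs))) / fact n" for b
  have q: "0 \<le> q" "q \<le> 1" using l r by (auto simp: q_def)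
  have g: "0 \<le> g b" for b
    unfolding g_def using q by (intro divide_nonneg_nonneg gap_mean_nonneg) auto
  have meas: "Measurable.pred (PiM (set (i # ns)) (\<lambda>_. E)) (\<lambda>x. ordered_gap_event r R a (map x (i # ns)))"
  proof -
    have "sets (PiM (set (i # ns)) (\<lambda>_. E)) = sets (PiM (set (i # ns)) (\<lambda>_. borel))"
      using sets_E by (intro sets_PiM_cong) auto
    from measurable_cong_sets[OF this refl] show ?thesis
      by (rule ssubst) (rule measurable_ordered_gap_event[OF order_refl])
  qed
  have "(\<integral>\<^sup>+x. indicator {x. ordered_gap_event r R a (map x (i # ns))} x \<partial>PiM (set (i # ns)) (\<lambda>_. E))
    = (\<integral>\<^sup>+y. (\<integral>\<^sup>+x. indicator {x. ordered_gap_event r R a (map x (i # ns))} (x(i := y)) \<partial>PiM (set ns) (\<lambda>_. E)) \<partial>E)"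
    unfolding list.set
    by (rule product_nn_integral_insert_rev) (use Cons.prems meas in \<open>auto simp: indicator_def\<close>)
  \<comment> \<open>The two terms are the first gap being short and long.\<close>
  also have "\<dots> = (\<integral>\<^sup>+y. ennreal (g False * exp (- (real n * l * y))) * indicator {a<..a + r} y
      + ennreal (g True * exp (- (real n * l * y))) * indicator {a + r<..} y \<partial>E)"
  proof (rule nn_integral_cong)
    fix y
    have upd: "map (x(i := y)) (i # ns) = y # map x ns" for x :: "'a \<Rightarrow> real"
      using Cons.prems by (auto simp: map_fun_upd)
    show "(\<integral>\<^sup>+x. indicator {x. ordered_gap_event r R a (map x (i # ns))} (x(i := y)) \<partial>PiM (set ns) (\<lambda>_. E))
      = ennreal (g False * exp (- (real n * l * y))) * indicator {a<..a + r} y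
      + ennreal (g True * exp (- (real n * l * y))) * indicator {a + r<..} y"
    proof (cases "a < y")
      case False
      then have "\<not> ordered_gap_event r R a (map (x(i := y)) (i # ns))" for x
        unfolding upd by (simp add: ordered_gap_event_Cons)
      then show ?thesis using False r by (simp add: indicator_def del: list.map)
    next
      case True
      have "(\<integral>\<^sup>+x. indicator {x. ordered_gap_event r R a (map x (i # ns))} (x(i := y)) \<partial>PiM (set ns) (\<lambda>_. E))
        = (\<integral>\<^sup>+x. indicator {x. ordered_gap_event r (\<lambda>bs. R ((r < y - a) # bs)) y (map x ns)} x \<partial>PiM (set ns) (\<lambda>_. E))"
        using True unfolding indicator_def mem_Collect_eq upd by (simp add: ordered_gap_event_Cons)
      also have "\<dots> = ennreal (g (r < y - a) * exp (- (real n * l * y)))"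
        using Cons.IH[of y "\<lambda>bs. R ((r < y - a) # bs)"] True Cons.prems
        by (simp add: g_def n_def q_def)
      finally show ?thesis using True by (auto simp: indicator_def)
    qed
  qed
  also have "\<dots> = (\<integral>\<^sup>+y. ennreal (g False * exp (- (real n * l * y))) * indicator {a<..a + r} y \<partial>E)
      + (\<integral>\<^sup>+y. ennreal (g True * exp (- (real n * l * y))) * indicator {a + r<..} y \<partial>E)"
    by (rule nn_integral_add) (auto simp: E_def)
  also have "\<dots> = ennreal (g False / Suc n * (exp (- (real (Suc n) * l * a)) - exp (- (real (Suc n) * l * (a + r)))))
      + ennreal (g True / Suc n * exp (- (real (Suc n) * l * (a + r))))"
    unfolding E_def using l r Cons.prems g
    by (subst nn_integral_exponential_Ioc nn_integral_exponential_greaterThan; simp)+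
  also have "\<dots> = ennreal (g False / Suc n * (exp (- (real (Suc n) * l * a)) - exp (- (real (Suc n) * l * (a + r))))
      + g True / Suc n * exp (- (real (Suc n) * l * (a + r))))"
    using l r g by (intro ennreal_plus[symmetric] mult_nonneg_nonneg divide_nonneg_nonneg) auto
  also have "exp (- (real (Suc n) * l * (a + r))) = q ^ Suc n * exp (- (real (Suc n) * l * a))"
    unfolding q_def exp_of_nat_mult[symmetric] exp_add[symmetric] by (simp add: algebra_simps)
  also have "g False / Suc n * (exp (- (real (Suc n) * l * a)) - q ^ Suc n * exp (- (real (Suc n) * l * a)))
      + g True / Suc n * (q ^ Suc n * exp (- (real (Suc n) * l * a))) =
      (q ^ Suc n * (g True * fact n) + (1 - q ^ Suc n) * (g False * fact n)) / fact (Suc n) * exp (- (real (Suc n) * l * a))"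
  proof -
    have "u / S * (e - Q * e) + v / S * (Q * e) = (Q * (v * F) + (1 - Q) * (u * F)) / (S * F) * e"
      if "S \<noteq> 0" "F \<noteq> 0" for u v S Q e F :: real
      using that by (simp add: field_simps)
    from this[of "real (Suc n)" "fact n"] show ?thesis unfolding fact_Suc by simp
  qed
  also have "q ^ Suc n * (g True * fact n) + (1 - q ^ Suc n) * (g False * fact n) =
      gap_mean q (Suc n) (\<lambda>bs. of_bool (R bs))"
    by (simp add: g_def)
  finally show ?case by (simp only: q_def n_def length_Cons)
qed

section \<open>Components as runs of short gaps\<close>

text \<open>
  A component is a long gap together with the short gaps that follow it, each bit standing for
  the point behind the gap. The gap in front of the first point always opens a component,
  be it long or short.
\<close>

function block_sizes :: "bool list \<Rightarrow> nat list" where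
  "block_sizes [] = []"
| "block_sizes (b # bs) = Suc (length (takeWhile Not bs)) # block_sizes (dropWhile Not bs)"
  by pat_completeness auto
termination
  by (relation "Wellfounded.measure length") (auto simp: less_Suc_eq_le length_dropWhile_le)

fun clusters :: "real \<Rightarrow> ('b \<Rightarrow> real) \<Rightarrow> 'b list \<Rightarrow> 'b list list" where
  "clusters r x [] = []"
| "clusters r x [i] = [[i]]"
| "clusters r x (i # j # ns) =
     (if r < x j - x i then [i] # clusters r x (j # ns)
      else (i # hd (clusters r x (j # ns))) # tl (clusters r x (j # ns)))"

text \<open>
  The same recursion one bit at a time, as in \<^const>\<open>clusters\<close>.
\<close>

lemma block_sizes_step:
  "block_sizes (b # c # bs) = (if c then 1 # block_sizes (c # bs)
     else Suc (hd (block_sizes (c # bs))) # tl (block_sizes (c # bs)))"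
  by simp

lemma clusters_eq_Nil_iff [simp]: "clusters r x ns = [] \<longleftrightarrow> ns = []"
  by (induction r x ns rule: clusters.induct) auto

lemma length_clusters:
  "map length (clusters r x ns) = block_sizes (gaps r a (map x ns))"
proof (induction r x ns arbitrary: a rule: clusters.induct)
  case (3 r x i j ns)
  have ne: "clusters r x (j # ns) \<noteq> []" by simp
  show ?case
  proof (cases "r < x j - x i")
    case True
    then show ?thesis using "3.IH"(1)[of "x i"]
      by (simp del: block_sizes.simps add: block_sizes_step)
  next
    case False
    then show ?thesis using "3.IH"(2)[of "x i", symmetric] ne
      by (cases "clusters r x (j # ns)") (auto simp: block_sizes_step simp del: block_sizes.simps)
  qed
qed auto

lemma concat_clusters [simp]: "concat (clusters r x ns) = ns"
proof (induction r x ns rule: clusters.induct)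
  case (3 r x i j ns)
  have "clusters r x (j # ns) \<noteq> []" by simp
  then show ?case using 3 by (cases "clusters r x (j # ns)") auto
qed auto

lemma Nil_notin_clusters: "[] \<notin> set (clusters r x ns)"
proof (induction r x ns rule: clusters.induct)
  case (3 r x i j ns)
  have "clusters r x (j # ns) \<noteq> []" by simp
  then show ?case using 3 by (cases "clusters r x (j # ns)") (auto split: if_splits)
qed auto

lemma successively_clusters:
  "c \<in> set (clusters r x ns) \<Longrightarrow> successively (\<lambda>i j. x j - x i \<le> r) c"
proof (induction r x ns arbitrary: c rule: clusters.induct)
  case (3 r x i j ns)
  obtain d ds where cl: "clusters r x (j # ns) = d # ds"
    by (cases "clusters r x (j # ns)") auto
  moreover from cl have "d \<noteq> []" using Nil_notin_clusters[of r x "j # ns"] by auto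
  moreover from this cl have "hd d = j"
    using concat_clusters[of r x "j # ns"] by (cases d) auto
  ultimately show ?case
    using 3 by (auto simp: successively_Cons split: if_splits)
qed auto

lemma separated_clusters:
  assumes "sorted (map x ns)"
  shows "sorted_wrt (\<lambda>c d. \<forall>i\<in>set c. \<forall>j\<in>set d. r < x j - x i) (clusters r x ns)"
  using assms
proof (induction r x ns rule: clusters.induct)
  case (3 r x i j ns)
  obtain d ds where cl: "clusters r x (j # ns) = d # ds"
    by (cases "clusters r x (j # ns)") auto
  have d: "d \<noteq> []" using Nil_notin_clusters[of r x "j # ns"] cl by auto
  from this cl have hd: "hd d = j"
    using concat_clusters[of r x "j # ns"] by (cases d) auto
  have mem: "set (j # ns) = (\<Union>c\<in>set (d # ds). set c)"
    using concat_clusters[of r x "j # ns"] cl by (metis set_concat)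
  show ?case
  proof (cases "r < x j - x i")
    case True
    have "x j \<le> x v" if "v \<in> set c" "c \<in> set (d # ds)" for v c
    proof -
      have "v \<in> set (j # ns)" using that mem by blast
      then show ?thesis using "3.prems" by auto
    qed
    with True 3 cl show ?thesis by fastforce
  next
    case False
    have "r < x v - x i" if "v \<in> set c" "c \<in> set ds" for v c
    proof -
      have "j \<in> set d" using d hd by (cases d) auto
      then have "r < x v - x j" using 3 False cl that by auto
      then show ?thesis using "3.prems" by auto
    qed
    with False 3 cl show ?thesis by auto
  qed
qed auto

lemma quotient_rtrancl_eqI:
  assumes part: "\<Union>P = A" "{} \<notin> P"
    and conn: "\<And>c i j. c \<in> P \<Longrightarrow> i \<in> c \<Longrightarrow> j \<in> c \<Longrightarrow> (i, j) \<in> E\<^sup>*"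
    and closed: "\<And>c i j. c \<in> P \<Longrightarrow> i \<in> c \<Longrightarrow> (i, j) \<in> E \<Longrightarrow> j \<in> c"
  shows "A // E\<^sup>* = P"
proof -
  have cls: "E\<^sup>* `` {i} = c" if "c \<in> P" "i \<in> c" for i c
  proof -
    have "j \<in> c" if "(i, j) \<in> E\<^sup>*" for j
      using that by induction (use \<open>i \<in> c\<close> closed[OF \<open>c \<in> P\<close>] in auto)
    with conn[OF that] show ?thesis by auto
  qed
  show ?thesis
  proof (intro equalityI subsetI)
    fix c assume "c \<in> A // E\<^sup>*"
    then obtain i where "i \<in> A" "c = E\<^sup>* `` {i}" by (auto elim: quotientE)
    with part cls show "c \<in> P" by blast
  next
    fix c assume c: "c \<in> P"
    with part obtain i where "i \<in> c" by (metis equals0I)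
    with c cls[of c i] part show "c \<in> A // E\<^sup>*" by (auto intro: quotientI)
  qed
qed

lemma successively_imp_rtrancl:
  assumes "successively (\<lambda>i j. (i, j) \<in> R) c" "sym R" "i \<in> set c" "j \<in> set c"
  shows "(i, j) \<in> R\<^sup>*"
proof -
  have hd: "(hd c, k) \<in> R\<^sup>*" if "k \<in> set c" for k
    using assms(1) that
  proof (induction c)
    case (Cons a c)
    show ?case
    proof (cases "k = a")
      case False
      then have "(hd c, k) \<in> R\<^sup>*" "(a, hd c) \<in> R" using Cons by (auto simp: successively_Cons)
      then show ?thesis by (simp add: converse_rtrancl_into_rtrancl)
    qed simp
  qed simp
  have "(i, hd c) \<in> R\<^sup>*" using hd[OF assms(3)] assms(2) by (meson sym_rtrancl symD)
  then show ?thesis using hd[OF assms(4)] by (rule rtrancl_trans)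
qed

text \<open>
  Consecutive points of a cluster are joined by an edge, and points of different clusters are
  more than \<open>r\<close> apart because the long gap between the clusters separates them.
\<close>

lemma geom_components_eq_clusters:
  assumes ns: "distinct ns" "set ns = {1..n}" "sorted (map x ns)" and "0 \<le> r"
  shows "geom_components n r x = set ` set (clusters r x ns)"
  unfolding geom_components_def
proof (rule quotient_rtrancl_eqI)
  let ?E = "geom_edges n r x"
  show U: "\<Union>(set ` set (clusters r x ns)) = {1..n}"
    using concat_clusters[of r x ns] ns(2) by (metis set_concat)
  show "{} \<notin> set ` set (clusters r x ns)"
    using Nil_notin_clusters[of r x ns] by auto
  show "(i, j) \<in> ?E\<^sup>*" if "c \<in> set ` set (clusters r x ns)" "i \<in> c" "j \<in> c" for c i j
  proof -
    from that obtain d where d: "d \<in> set (clusters r x ns)" "c = set d" by auto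
    obtain us vs where uv: "clusters r x ns = us @ d # vs"
      using d(1) by (meson split_list)
    have nsd: "ns = concat us @ d @ concat vs"
      using concat_clusters[of r x ns] uv by simp
    have "sorted_wrt (\<lambda>i j. x i \<le> x j) d" "distinct d"
      using ns(1,3) unfolding nsd sorted_map by (auto simp: sorted_wrt_append)
    then have srt: "successively (\<lambda>i j. x i \<le> x j \<and> i \<noteq> j) d"
      by (intro successively_if_sorted_wrt) (simp add: sorted_wrt_iff_nth_less nth_eq_iff_index_eq)
    have sub: "set d \<subseteq> {1..n}" using ns(2) nsd by auto
    have "successively (\<lambda>i j. (i, j) \<in> ?E) d"
    proof -
      have "successively (\<lambda>i j. x j - x i \<le> r \<and> x i \<le> x j \<and> i \<noteq> j) d"
        using successively_clusters[OF d(1)] srt by (simp add: successively_conv_nth)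
      then show ?thesis
        by (rule successively_mono) (use sub in \<open>auto simp: geom_edges_def\<close>)
    qed
    moreover have "sym ?E" by (auto simp: sym_def geom_edges_def abs_minus_commute)
    ultimately show ?thesis using that d(2) by (auto intro: successively_imp_rtrancl)
  qed
  show "j \<in> c" if c: "c \<in> set ` set (clusters r x ns)" "i \<in> c" "(i, j) \<in> ?E" for c i j
  proof -
    from c(1) obtain p where p: "p < length (clusters r x ns)" "c = set (clusters r x ns ! p)"
      by (auto simp: in_set_conv_nth)
    have "j \<in> {1..n}" "\<bar>x i - x j\<bar> \<le> r" using c(3) by (auto simp: geom_edges_def)
    then obtain p' where p': "p' < length (clusters r x ns)" "j \<in> set (clusters r x ns ! p')"
      unfolding U[symmetric] by (metis UN_E in_set_conv_nth)
    have sep: "r < x v - x u" if "u \<in> set (clusters r x ns ! a)" "v \<in> set (clusters r x ns ! b)"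
      "a < b" "b < length (clusters r x ns)" for a b u v
      using separated_clusters[OF ns(3), of r] that by (auto simp: sorted_wrt_iff_nth_less)
    have "p = p'"
    proof (rule ccontr)
      assume "p \<noteq> p'"
      then consider "p < p'" | "p' < p" by linarith
      then show False
      proof cases
        case 1
        then show False using sep[of i p j p'] c(2) p p' \<open>\<bar>x i - x j\<bar> \<le> r\<close> by auto
      next
        case 2
        then show False using sep[of j p' i p] c(2) p p' \<open>\<bar>x i - x j\<bar> \<le> r\<close> by auto
      qed
    qed
    then show ?thesis using p p' by simp
  qed
qed

text \<open>
  Nonempty blocks of a list without repetitions are disjoint; hence components can be counted
  on the list of clusters.
\<close>

lemma distinct_map_set_clusters:
  assumes "distinct ns"
  shows "distinct (map set (clusters r x ns))"
proof -
  have "distinct (concat cs) \<Longrightarrow> [] \<notin> set cs \<Longrightarrow> distinct (map set cs)" for cs :: "'a list list"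
  proof (induction cs)
    case (Cons c cs)
    then show ?case by (cases c) auto
  qed simp
  from this[of "clusters r x ns"] show ?thesis using assms Nil_notin_clusters[of r x ns] by simp
qed

lemma ex_sorting_permutation:
  fixes x :: "'b \<Rightarrow> real"
  obtains ns where "mset ns = mset us" "map x ns = sort (map x us)"
proof
  show "mset (sort_key x us) = mset us" by simp
  show "map x (sort_key x us) = sort (map x us)"
    by (rule properties_for_sort[symmetric]) simp_all
qed

lemma ex_sorted_nodes:
  fixes x :: "nat \<Rightarrow> real"
  obtains ns where "distinct ns" "set ns = {1..n}" "map x ns = sort (map x [1..<Suc n])"
proof -
  obtain ns where ns: "mset ns = mset [1..<Suc n]" "map x ns = sort (map x [1..<Suc n])"
    by (rule ex_sorting_permutation[where x = x and us = "[1..<Suc n]"])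
  have "distinct ns" "set ns = {1..n}"
    unfolding mset_eq_imp_distinct_iff[OF ns(1)] mset_eq_setD[OF ns(1)] by auto
  then show ?thesis using ns(2) by (rule that)
qed

lemma card_components_of_size:
  assumes "0 \<le> r"
  shows "card {C \<in> geom_components n r x. card C = m} =
    count_list (block_sizes (gaps r 0 (sort (map x [1..<Suc n])))) m"
proof -
  obtain ns where ns: "distinct ns" "set ns = {1..n}" "map x ns = sort (map x [1..<Suc n])"
    by (rule ex_sorted_nodes)
  let ?cs = "clusters r x ns"
  have srt: "sorted (map x ns)" using ns(3) by (simp del: upt_Suc)
  have dist: "distinct c" if "c \<in> set ?cs" for c
  proof -
    from that obtain us vs where "?cs = us @ c # vs" by (meson split_list)
    then have "distinct (concat us @ c @ concat vs)"
      using ns(1) concat_clusters[of r x ns] by simp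
    then show ?thesis by simp
  qed
  have "{C \<in> geom_components n r x. card C = m} = set ` {c \<in> set ?cs. length c = m}"
    unfolding geom_components_eq_clusters[OF ns(1,2) srt assms]
    using dist by (auto simp: distinct_card)
  then have "card {C \<in> geom_components n r x. card C = m} = card (set ` {c \<in> set ?cs. length c = m})"
    by simp
  also have "\<dots> = card {c \<in> set ?cs. length c = m}"
    using distinct_map_set_clusters[OF ns(1), of r x]
    by (intro card_image) (auto simp: distinct_map inj_on_def)
  also have "\<dots> = length (filter (\<lambda>c. length c = m) ?cs)"
    using distinct_map_set_clusters[OF ns(1), of r x]
    by (subst distinct_length_filter) (auto simp: distinct_map Int_def conj_commute)
  also have "\<dots> = count_list (map length ?cs) m"
    by (simp add: count_list_eq_length_filter filter_map o_def eq_commute)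
  also have "\<dots> = count_list (block_sizes (gaps r 0 (map x ns))) m"
    by (simp add: length_clusters[where a = 0])
  finally show ?thesis unfolding ns(3) .
qed

text \<open>
  The size of the first component, expressed through the pattern that is left behind it, as in
  the renewal equation.
\<close>

definition first_size :: "bool list \<Rightarrow> nat" where
  "first_size bs = length bs - length (dropWhile Not (tl bs))"

lemma first_size_eq_hd: "bs \<noteq> [] \<Longrightarrow> first_size bs = hd (block_sizes bs)"
proof (cases bs)
  case (Cons b cs)
  have "length cs = length (takeWhile Not cs) + length (dropWhile Not cs)"
    by (metis length_append takeWhile_dropWhile_id)
  with Cons show ?thesis by (simp add: first_size_def)
qed (simp add: first_size_def)

text \<open>
  If points coincide, several ranks \<open>j\<close> may carry the largest value of the first component. The
  characterisation therefore compares values instead of ranks; for distinct points it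
  determines \<open>j\<close>.
\<close>

lemma last_node_of_first_iff:
  fixes x :: "nat \<Rightarrow> real" and n :: nat
  assumes "0 \<le> r"
  defines "ys \<equiv> sort (map x [1..<Suc n])"
  shows "last_node_of_first n r x j \<longleftrightarrow>
    j \<in> {1..n} \<and> ys ! (j - 1) = ys ! (first_size (gaps r 0 ys) - 1)"
proof (cases "n = 0")
  case False
  obtain ns where ns: "distinct ns" "set ns = {1..n}" "map x ns = ys"
    unfolding ys_def by (rule ex_sorted_nodes)
  let ?cs = "clusters r x ns"
  have srt: "sorted (map x ns)" using ns(3) by (simp add: ys_def)
  have ne: "ns \<noteq> []" using ns(2) False by auto
  then obtain d ds where cs: "?cs = d # ds"
    by (cases ?cs) auto
  have nsd: "ns = d @ concat ds" using cs concat_clusters[of r x ns] by simp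
  have d: "d \<noteq> []" using Nil_notin_clusters[of r x ns] cs by auto
  have comps: "geom_components n r x = set ` set ?cs"
    by (rule geom_components_eq_clusters[OF ns(1,2) srt assms(1)])
  have len: "length d = first_size (gaps r 0 ys)"
  proof -
    have "gaps r 0 ys \<noteq> []" using ne ns(3) by (metis length_0_conv length_gaps length_map)
    moreover have "length d = hd (block_sizes (gaps r 0 ys))"
      using length_clusters[of r x ns 0] cs ns(3) by (metis list.sel(1) list.simps(9))
    ultimately show ?thesis by (simp add: first_size_eq_hd)
  qed
  have Max: "Max (x ` set d) = ys ! (length d - 1)"
  proof (rule Max_eqI)
    have last: "ys ! (length d - 1) = x (last d)"
      using d by (simp add: ns(3)[symmetric] nsd nth_append last_conv_nth)
    then show "ys ! (length d - 1) \<in> x ` set d" using d by simp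
    fix v assume "v \<in> x ` set d"
    then obtain p where p: "p < length d" "v = x (d ! p)" by (auto simp: in_set_conv_nth)
    then have "ys ! p = v" by (simp add: ns(3)[symmetric] nsd nth_append)
    moreover have "ys ! p \<le> ys ! (length d - 1)"
      using srt p nsd unfolding ns(3) by (intro sorted_nth_mono) (auto simp flip: ns(3))
    ultimately show "v \<le> ys ! (length d - 1)" by simp
  qed simp
  have first: "order_stat n x 1 = x (hd d)"
    unfolding order_stat_def ys_def[symmetric] ns(3)[symmetric]
    using d by (simp add: nsd hd_conv_nth nth_append)
  have uniq: "C = set d" if "C \<in> geom_components n r x" "order_stat n x 1 \<in> x ` C" for C
  proof (rule ccontr)
    assume "C \<noteq> set d"
    with that(1) comps cs obtain c where c: "c \<in> set ds" "C = set c" by auto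
    from that(2) c first obtain i where i: "i \<in> set c" "x i = x (hd d)" by auto
    have "hd d \<in> set d" using d by simp
    moreover have "\<forall>c\<in>set ds. \<forall>i\<in>set d. \<forall>j\<in>set c. r < x j - x i"
      using separated_clusters[OF srt, of r] cs by simp
    ultimately have "r < x i - x (hd d)" using c(1) i(1) by blast
    with i assms(1) show False by simp
  qed
  have "last_node_of_first n r x j \<longleftrightarrow> j \<in> {1..n} \<and> Max (x ` set d) = order_stat n x j"
    unfolding last_node_of_first_def
    using uniq first comps cs d by (metis hd_in_set image_eqI list.set_intros(1))
  then show ?thesis
    using Max len by (auto simp: order_stat_def ys_def simp del: upt_Suc)
qed (simp add: last_node_of_first_def)

section \<open>Laws of sorted exponential samples\<close>

lemma distr_exponential_sample:
  assumes "exponential_sample l n M X" "n \<ge> 1"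
  shows "distr M (PiM {1..n} (\<lambda>_. borel)) (\<lambda>\<omega>. \<lambda>i\<in>{1..n}. X i \<omega>)
    = PiM {1..n} (\<lambda>_. density lborel (exponential_density l))"
proof -
  have M: "prob_space M" and ind: "prob_space.indep_vars M (\<lambda>_. borel) X {1..n}"
    and D: "\<And>i. i \<in> {1..n} \<Longrightarrow> distributed M lborel (X i) (exponential_density l)"
    using assms(1) by (auto simp: exponential_sample_def)
  interpret prob_space M by fact
  have rv: "X i \<in> borel_measurable M" if "i \<in> {1..n}" for i
    using distributed_measurable[OF D[OF that]] by simp
  have "distr M (PiM {1..n} (\<lambda>_. borel)) (\<lambda>\<omega>. \<lambda>i\<in>{1..n}. X i \<omega>) = PiM {1..n} (\<lambda>i. distr M borel (X i))"
    using indep_vars_iff_distr_eq_PiM'[of "{1..n}" X "\<lambda>_. borel"] rv ind assms(2) by auto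
  also have "\<dots> = PiM {1..n} (\<lambda>_. density lborel (exponential_density l))"
  proof (rule PiM_cong)
    fix i assume "i \<in> {1..n}"
    have "distr M borel (X i) = distr M lborel (X i)" by (rule distr_cong) auto
    with distributed_distr_eq_density[OF D[OF \<open>i \<in> {1..n}\<close>]]
    show "distr M borel (X i) = density lborel (exponential_density l)" by simp
  qed simp
  finally show ?thesis .
qed

lemma sorted_arrangement_unique:
  fixes x :: "'b \<Rightarrow> real"
  assumes "sorted_wrt (<) (map x ns)" "sorted_wrt (<) (map x ns')" "set ns = set ns'"
  shows "ns = ns'"
proof -
  have "map x ns = map x ns'"
    using assms by (intro sorted_distinct_set_unique) (auto simp: strict_sorted_iff)
  moreover have "inj_on x (set ns \<union> set ns')"
    using assms by (auto simp: strict_sorted_iff distinct_map)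
  ultimately show ?thesis by (rule map_inj_on)
qed

text \<open>
  The law of a statistic of the sorted sample which is determined by the gap pattern when all
  points are positive and distinct. The events that the nodes are strictly ordered as a given
  permutation are disjoint and have probability \<open>1 / fact n\<close> each, so ties and
  nonpositive points have probability zero without a separate computation. Measurability is
  required of \<open>Q\<close> along fixed arrangements of the nodes only, since sorting amounts to
  choosing one of finitely many arrangements.
\<close>

lemma prob_sorted_sample:
  fixes l r :: real
  assumes l: "l > 0" and r: "r > 0" and ES: "exponential_sample l n M X"
    and meas: "\<And>ns. set ns = {1..n} \<Longrightarrow> distinct ns \<Longrightarrow>
      Measurable.pred (PiM {1..n} (\<lambda>_. borel)) (\<lambda>x. Q (map x ns))"
    and QR: "\<And>ys. length ys = n \<Longrightarrow> sorted_wrt (<) (0 # ys) \<Longrightarrow> Q ys \<longleftrightarrow> R (gaps r 0 ys)"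
  shows "measure M {\<omega> \<in> space M. Q (sort (map (\<lambda>i. X i \<omega>) [1..<Suc n]))} =
    gap_mean (exp (- (l * r))) n (\<lambda>bs. of_bool (R bs))"
proof (cases "n = 0")
  case True
  have "prob_space M" using ES by (simp add: exponential_sample_def)
  then show ?thesis using True QR[of "[]"] by (simp add: prob_space.prob_space)
next
  case False
  define E where "E = density lborel (exponential_density l)"
  define P where "P = PiM {1..n} (\<lambda>_. E)"
  define q where "q = exp (- (l * r))"
  define arr where "arr = permutations_of_set {1..n}"
  have q: "0 \<le> q" "q \<le> 1" using l r by (auto simp: q_def)
  have arr: "distinct ns" "set ns = {1..n}" "length ns = n" if "ns \<in> arr" for ns
    using that by (auto simp: arr_def permutations_of_set_def distinct_card[symmetric])
  have sort_arr: "sort (map x [1..<Suc n]) = map x ns" if "ns \<in> arr" "sorted (map x ns)"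
    for ns and x :: "nat \<Rightarrow> real"
  proof -
    have "set ns = set [1..<Suc n]"
      unfolding arr(2)[OF that(1)] by auto
    then have "mset ns = mset [1..<Suc n]"
      unfolding set_eq_iff_mset_eq_distinct[OF arr(1)[OF that(1)] distinct_upt] .
    then show ?thesis
      using that(2) by (intro properties_for_sort) (simp_all del: upt_Suc)
  qed
  have fin: "finite arr" and card: "card arr = fact n" by (simp_all add: arr_def)
  have sets_P: "sets P = sets (PiM {1..n} (\<lambda>_. borel))"
    by (auto simp: P_def E_def intro!: sets_PiM_cong)
  interpret P: prob_space P
    unfolding P_def E_def by (intro prob_space_PiM prob_space_exponential_density l)
  define D where "D S ns = {x \<in> space P. ordered_gap_event r S 0 (map x ns)}" for S ns
  have D_sets: "D S ns \<in> sets P" if "ns \<in> arr" for S ns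
    using measurable_ordered_gap_event[of ns "{1..n}" r S 0] arr[OF that] sets_P
    by (simp add: D_def pred_def sets_eq_imp_space_eq[OF sets_P])
  have D_prob: "P.prob (\<Union>ns\<in>arr. D S ns) = gap_mean q n (\<lambda>bs. of_bool (S bs))" for S
  proof -
    have one: "P.prob (D S ns) = gap_mean q n (\<lambda>bs. of_bool (S bs)) / fact n" if "ns \<in> arr" for ns
    proof -
      have "emeasure P (D S ns) = (\<integral>\<^sup>+x. indicator (D S ns) x \<partial>P)"
        using D_sets[OF that] by simp
      also have "\<dots> = (\<integral>\<^sup>+x. indicator {x. ordered_gap_event r S 0 (map x ns)} x \<partial>P)"
        by (rule nn_integral_cong) (auto simp: D_def indicator_def)
      also have "\<dots> = ennreal (gap_mean q n (\<lambda>bs. of_bool (S bs)) / fact n)"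
        using nn_integral_ordered_gap_event[OF l r order_refl arr(1)[OF that], of S] arr[OF that]
        by (simp add: P_def E_def q_def)
      finally show ?thesis
        using q by (simp add: measure_def gap_mean_nonneg)
    qed
    have "P.prob (\<Union>ns\<in>arr. D S ns) = (\<Sum>ns\<in>arr. P.prob (D S ns))"
    proof (rule P.finite_measure_finite_Union[OF fin])
      show "D S ` arr \<subseteq> sets P" using D_sets by auto
      show "disjoint_family_on (D S) arr"
        unfolding disjoint_family_on_def
      proof (intro ballI impI)
        fix ns ns' assume "ns \<in> arr" "ns' \<in> arr" "ns \<noteq> ns'"
        then show "D S ns \<inter> D S ns' = {}"
          using sorted_arrangement_unique[of _ ns ns'] arr(2)
          by (auto simp: D_def ordered_gap_event_def)
      qed
    qed
    also have "\<dots> = gap_mean q n (\<lambda>bs. of_bool (S bs))"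
      using one card by simp
    finally show ?thesis .
  qed
  define A where "A = {x \<in> space P. Q (sort (map x [1..<Suc n]))}"
  \<comment> \<open>Weak orderings cover the whole space, ties included; this yields measurability of \<open>A\<close>.\<close>
  have A_eq: "A = (\<Union>ns\<in>arr. {x \<in> space P. sorted_wrt (\<le>) (map x ns) \<and> Q (map x ns)})"
  proof (intro equalityI subsetI)
    fix x assume "x \<in> A"
    moreover obtain ns where "distinct ns" "set ns = {1..n}" "map x ns = sort (map x [1..<Suc n])"
      by (rule ex_sorted_nodes)
    ultimately show "x \<in> (\<Union>ns\<in>arr. {x \<in> space P. sorted_wrt (\<le>) (map x ns) \<and> Q (map x ns)})"
      by (auto simp: A_def arr_def permutations_of_set_def simp del: upt_Suc intro!: bexI[of _ ns])
  next
    fix x assume "x \<in> (\<Union>ns\<in>arr. {x \<in> space P. sorted_wrt (\<le>) (map x ns) \<and> Q (map x ns)})"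
    then obtain ns where ns: "ns \<in> arr" "x \<in> space P" "sorted (map x ns)" "Q (map x ns)" by auto
    with sort_arr[OF ns(1,3)] show "x \<in> A" by (simp add: A_def del: upt_Suc)
  qed
  have comp: "(\<lambda>x. x i) \<in> borel_measurable (PiM {1..n} (\<lambda>_. borel :: real measure))" if "i \<in> {1..n}" for i
    using that by (rule measurable_component_singleton)
  have A_sets: "A \<in> sets P"
    unfolding A_eq
  proof (rule sets.finite_UN[OF fin])
    fix ns assume ns: "ns \<in> arr"
    have [measurable]: "Measurable.pred (PiM {1..n} (\<lambda>_. borel)) (\<lambda>x. Q (map x ns))"
      using meas arr[OF ns] by auto
    have [measurable]: "Measurable.pred (PiM {1..n} (\<lambda>_. borel :: real measure)) (\<lambda>x. sorted_wrt (\<le>) (map x ns))"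
    proof (rule measurable_sorted_wrt_map)
      fix i j assume "i \<in> {1..n}" "j \<in> {1..n}"
      from borel_measurable_le[OF comp[OF this(1)] comp[OF this(2)]]
      show "Measurable.pred (PiM {1..n} (\<lambda>_. borel :: real measure)) (\<lambda>x. x i \<le> x j)"
        by (simp add: pred_def)
    qed (use arr[OF ns] in simp)
    have "Measurable.pred (PiM {1..n} (\<lambda>_. borel)) (\<lambda>x. sorted_wrt (\<le>) (map x ns) \<and> Q (map x ns))"
      by measurable
    then show "{x \<in> space P. sorted_wrt (\<le>) (map x ns) \<and> Q (map x ns)} \<in> sets P"
      by (simp add: pred_def sets_P sets_eq_imp_space_eq[OF sets_P])
  qed
  have "P.prob A = P.prob (\<Union>ns\<in>arr. D R ns)"
  proof (rule P.finite_measure_eq_AE)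
    \<comment> \<open>The trivial pattern condition has mean 1, so almost every point is strictly ordered.\<close>
    have "AE x in P. x \<in> (\<Union>ns\<in>arr. D (\<lambda>_. True) ns)"
      using D_prob[of "\<lambda>_. True"] D_sets fin by (intro P.AE_in_set_eq_1[THEN iffD2]) auto
    then show "AE x in P. x \<in> A \<longleftrightarrow> x \<in> (\<Union>ns\<in>arr. D R ns)"
    proof eventually_elim
      case (elim x)
      then obtain ns where ns: "ns \<in> arr" "x \<in> space P" "sorted_wrt (<) (0 # map x ns)"
        by (auto simp: D_def ordered_gap_event_def)
      have "sort (map x [1..<Suc n]) = map x ns"
        using ns(3) by (intro sort_arr[OF ns(1)]) (simp add: strict_sorted_iff)
      then have "x \<in> A \<longleftrightarrow> R (gaps r 0 (map x ns))"
        using QR[OF _ ns(3)] arr(3)[OF ns(1)] ns(2) by (simp add: A_def del: upt_Suc)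
      moreover have "ns' = ns" if "ns' \<in> arr" "sorted_wrt (<) (0 # map x ns')" for ns'
        using sorted_arrangement_unique[of x ns' ns] that ns(3) arr(2)[OF ns(1)] arr(2)[OF that(1)]
        by simp
      then have "x \<in> (\<Union>ns\<in>arr. D R ns) \<longleftrightarrow> R (gaps r 0 (map x ns))"
        unfolding D_def ordered_gap_event_def using ns by blast
      ultimately show ?case by simp
    qed
    show "(\<Union>ns\<in>arr. D R ns) \<in> sets P" using D_sets by (intro sets.finite_UN fin)
  qed (rule A_sets)
  then have A_prob: "P.prob A = gap_mean q n (\<lambda>bs. of_bool (R bs))" using D_prob by simp
  let ?X = "\<lambda>\<omega>. \<lambda>i\<in>{1..n}. X i \<omega>"
  have P_eq: "P = distr M (PiM {1..n} (\<lambda>_. borel)) ?X"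
    using distr_exponential_sample[OF ES] False by (simp add: P_def E_def)
  have X_meas: "?X \<in> M \<rightarrow>\<^sub>M PiM {1..n} (\<lambda>_. borel)"
    using ES by (intro measurable_restrict) (auto simp: exponential_sample_def dest!: bspec distributed_measurable)
  have "P.prob A = measure M (?X -` A \<inter> space M)"
    using A_sets X_meas sets_P by (subst P_eq) (simp add: measure_distr)
  also have "?X -` A \<inter> space M = {\<omega> \<in> space M. Q (sort (map (\<lambda>i. X i \<omega>) [1..<Suc n]))}"
  proof -
    have "map (?X \<omega>) [1..<Suc n] = map (\<lambda>i. X i \<omega>) [1..<Suc n]" for \<omega>
      by (intro map_cong refl) auto
    moreover have "?X \<omega> \<in> space P" if "\<omega> \<in> space M" for \<omega>
      using measurable_space[OF X_meas that] sets_eq_imp_space_eq[OF sets_P] by simp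
    ultimately show ?thesis by (auto simp: A_def simp del: upt_Suc map_eq_conv)
  qed
  finally show ?thesis using A_prob by (simp add: q_def)
qed

definition count_law :: "real \<Rightarrow> nat \<Rightarrow> nat \<Rightarrow> nat \<Rightarrow> real" where
  "count_law q n m k = gap_mean q n (\<lambda>bs. of_bool (count_list (block_sizes bs) m = k))"

lemma component_count_prob_eq:
  assumes "l > 0" "r > 0" "exponential_sample l n M X"
  shows "component_count_prob M X r n m k = count_law (exp (- (l * r))) n m k"
proof -
  have "component_count_prob M X r n m k = measure M {\<omega> \<in> space M.
      count_list (block_sizes (gaps r 0 (sort (map (\<lambda>i. X i \<omega>) [1..<Suc n])))) m = k}"
    using assms(2) by (simp add: component_count_prob_def card_components_of_size del: upt_Suc)
  also have "\<dots> = count_law (exp (- (l * r))) n m k"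
    unfolding count_law_def
  proof (rule prob_sorted_sample[OF assms])
    fix ns assume "set ns = {1..n}"
    then have [measurable]: "(\<lambda>x. gaps r 0 (map x ns)) \<in> PiM {1..n} (\<lambda>_. borel) \<rightarrow>\<^sub>M count_space UNIV"
      by (intro measurable_gaps) auto
    show "Measurable.pred (PiM {1..n} (\<lambda>_. borel))
      (\<lambda>x. count_list (block_sizes (gaps r 0 (map x ns))) m = k)"
      by measurable
  qed simp
  finally show ?thesis .
qed

text \<open>
  Almost surely, the first component ends at rank \<open>n - s\<close> if and only if \<open>s\<close> points are left
  behind it, so the renewal equation for the indicator of that event has a single nonzero term.
\<close>

lemma last_node_prob_eq:
  assumes "l > 0" "r > 0" "exponential_sample l n M X" "s < n"
  shows "last_node_prob M X r n (n - s) = nodes_left_prob (exp (- (l * r))) n s"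
proof -
  let ?q = "exp (- (l * r))"
  let ?last = "\<lambda>bs. first_size bs - 1"
  have "last_node_prob M X r n (n - s) = measure M {\<omega> \<in> space M.
      sort (map (\<lambda>i. X i \<omega>) [1..<Suc n]) ! (n - s - 1) =
      sort (map (\<lambda>i. X i \<omega>) [1..<Suc n]) ! ?last (gaps r 0 (sort (map (\<lambda>i. X i \<omega>) [1..<Suc n])))}"
    using assms(2,4) by (simp add: last_node_prob_def last_node_of_first_iff Suc_le_eq del: upt_Suc)
  also have "\<dots> = gap_mean ?q n (\<lambda>bs. of_bool (first_size bs = n - s))"
  proof (rule prob_sorted_sample[OF assms(1-3)])
    fix ns :: "nat list" assume ns: "set ns = {1..n}" "distinct ns"
    then have len: "length ns = n" by (metis card_atLeastAtMost diff_Suc_1 distinct_card)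
    have [measurable]: "(\<lambda>x. gaps r 0 (map x ns)) \<in> PiM {1..n} (\<lambda>_. borel) \<rightarrow>\<^sub>M count_space UNIV"
      using ns by (intro measurable_gaps) auto
    have comp: "(\<lambda>x. x (ns ! p)) \<in> borel_measurable (PiM {1..n} (\<lambda>_. borel :: real measure))" if "p < n" for p
      using ns len that nth_mem[of p ns] by (intro measurable_component_singleton) auto
    have eq: "Measurable.pred (PiM {1..n} (\<lambda>_. borel :: real measure)) (\<lambda>x. x (ns ! p) = x (ns ! p'))"
      if "p < n" "p' < n" for p p'
      using borel_measurable_eq[OF comp[OF that(1)] comp[OF that(2)]] by (simp add: pred_def)
    have last: "Measurable.pred (PiM {1..n} (\<lambda>_. borel :: real measure)) (\<lambda>x. ?last (gaps r 0 (map x ns)) = p)" for p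
      by measurable
    have bound: "?last (gaps r 0 (map x ns)) < n" for x
      using len assms(4) by (simp add: first_size_def)
    have "Measurable.pred (PiM {1..n} (\<lambda>_. borel))
      (\<lambda>x. \<exists>p\<in>{..<n}. ?last (gaps r 0 (map x ns)) = p \<and> x (ns ! (n - s - 1)) = x (ns ! p))"
      by (intro pred_intros_finite pred_intros_logic last eq) (use assms(4) in auto)
    also have "(\<lambda>x. \<exists>p\<in>{..<n}. ?last (gaps r 0 (map x ns)) = p \<and> x (ns ! (n - s - 1)) = x (ns ! p))
      = (\<lambda>x. map x ns ! (n - s - 1) = map x ns ! ?last (gaps r 0 (map x ns)))"
      using len bound assms(4) by (auto simp: fun_eq_iff)
    finally show "Measurable.pred (PiM {1..n} (\<lambda>_. borel))
      (\<lambda>x. map x ns ! (n - s - 1) = map x ns ! ?last (gaps r 0 (map x ns)))" .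
  next
    fix ys :: "real list" assume ys: "length ys = n" "sorted_wrt (<) (0 # ys)"
    then have "distinct ys" by (auto simp: strict_sorted_iff)
    moreover have "gaps r 0 ys \<noteq> []" using ys(1) assms(4) by (metis length_gaps length_0_conv not_less0)
    then have "0 < first_size (gaps r 0 ys)" "first_size (gaps r 0 ys) \<le> n"
      using length_dropWhile_le[of Not "tl (gaps r 0 ys)"] ys(1) assms(4)
      by (auto simp: first_size_def)
    ultimately show "ys ! (n - s - 1) = ys ! ?last (gaps r 0 ys) \<longleftrightarrow> first_size (gaps r 0 ys) = n - s"
      using ys(1) assms(4) by (subst nth_eq_iff_index_eq) auto
  qed
  also have "\<dots> = gap_mean ?q n (\<lambda>bs. (\<lambda>cs. of_bool (length cs = s)) (dropWhile Not (tl bs)))"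
  proof (rule gap_mean_cong)
    fix bs :: "bool list" assume "length bs = n"
    then show "of_bool (first_size bs = n - s) = (of_bool (length (dropWhile Not (tl bs)) = s) :: real)"
      using length_dropWhile_le[of Not "tl bs"] assms(4) by (auto simp: first_size_def)
  qed
  also have "\<dots> = (\<Sum>t<n. nodes_left_prob ?q n t * gap_mean ?q t (\<lambda>cs. of_bool (length cs = s)))"
    using gap_mean_renewal[of "\<lambda>cs. of_bool (length cs = s)" ?q "n - 1"] assms(4) by simp
  also have "\<dots> = (\<Sum>t<n. nodes_left_prob ?q n t * of_bool (t = s))"
  proof (intro sum.cong refl arg_cong2[where f = "(*)"])
    fix t
    have "gap_mean ?q t (\<lambda>cs. of_bool (length cs = s)) = gap_mean ?q t (\<lambda>_. of_bool (t = s))"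
      by (rule gap_mean_cong) simp
    then show "gap_mean ?q t (\<lambda>cs. of_bool (length cs = s)) = of_bool (t = s)" by simp
  qed
  also have "\<dots> = nodes_left_prob ?q n s"
    using assms(4) by (simp add: of_bool_def sum.delta' if_distrib cong: if_cong)
  finally show ?thesis .
qed

lemma count_law_bounds:
  assumes "0 \<le> q" "q \<le> 1"
  shows "0 \<le> count_law q n m k" "count_law q n m k \<le> 1"
  using gap_mean_nonneg[OF assms] gap_mean_mono[OF assms, of n _ "\<lambda>_. 1"]
  by (auto simp: count_law_def)

lemma sum_list_block_sizes: "sum_list (block_sizes bs) = length bs"
proof (induction bs rule: block_sizes.induct)
  case (2 b bs)
  have "length bs = length (takeWhile Not bs) + length (dropWhile Not bs)"
    by (metis length_append takeWhile_dropWhile_id)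
  with 2 show ?case by simp
qed simp

lemma count_list_le_sum_list: "m * count_list ns m \<le> sum_list (ns :: nat list)"
  by (induction ns) auto

lemma count_law_eq_0:
  assumes "n < m * k"
  shows "count_law q n m k = 0"
proof -
  have "count_law q n m k = gap_mean q n (\<lambda>_. 0)"
    unfolding count_law_def
  proof (rule gap_mean_cong)
    fix bs :: "bool list" assume "length bs = n"
    then have "count_list (block_sizes bs) m \<noteq> k"
      using assms count_list_le_sum_list[of m "block_sizes bs"] sum_list_block_sizes[of bs] by auto
    then show "of_bool (count_list (block_sizes bs) m = k) = (0 :: real)" by simp
  qed
  then show ?thesis by simp
qed

section \<open>The limit\<close>

text \<open>
  The weight \<open>c s\<close> is the probability that there are \<open>k\<close> components of size \<open>m\<close>, given that
  \<open>s\<close> nodes are left behind the first component. The first component itself is counted only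
  for \<open>s = n - m\<close>; for smaller \<open>s\<close> it is larger than \<open>m\<close>, and only the rest is counted.
\<close>

lemma count_law_renewal:
  assumes q: "0 \<le> q" "q \<le> 1" and n: "n \<ge> 1"
  obtains c where "\<And>s. 0 \<le> c s" "\<And>s. c s \<le> 1" "\<And>s. s + m < n \<Longrightarrow> c s = count_law q s m k"
    "count_law q n m k = (\<Sum>s<n. nodes_left_prob q n s * c s)"
proof
  define H :: "bool list \<Rightarrow> real" where
    "H bs = of_bool (of_bool (n - length bs = m) + count_list (block_sizes bs) m = k)" for bs
  let ?c = "\<lambda>s. gap_mean q s H"
  show "0 \<le> ?c s" for s using q by (intro gap_mean_nonneg) (auto simp: H_def)
  show "?c s \<le> 1" for s using gap_mean_mono[OF q, of s H "\<lambda>_. 1"] by (simp add: H_def)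
  show "?c s = count_law q s m k" if "s + m < n" for s
    unfolding count_law_def by (rule gap_mean_cong) (use that in \<open>auto simp: H_def\<close>)
  have "count_law q n m k = gap_mean q n (\<lambda>bs. H (dropWhile Not (tl bs)))"
    unfolding count_law_def
  proof (rule gap_mean_cong)
    fix bs :: "bool list" assume len: "length bs = n"
    with n obtain b cs where bs: "bs = b # cs" by (cases bs) auto
    have "length cs = length (takeWhile Not cs) + length (dropWhile Not cs)"
      by (metis length_append takeWhile_dropWhile_id)
    then have "Suc (length (takeWhile Not cs)) = n - length (dropWhile Not cs)"
      using len bs by simp
    then show "of_bool (count_list (block_sizes bs) m = k) = H (dropWhile Not (tl bs))"
      by (auto simp: bs H_def)
  qed
  also have "\<dots> = (\<Sum>s<n. nodes_left_prob q n s * ?c s)"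
    using gap_mean_renewal[of H q "n - 1"] n by (simp add: H_def)
  finally show "count_law q n m k = (\<Sum>s<n. nodes_left_prob q n s * ?c s)" .
qed

text \<open>
  For fixed \<open>s\<close> the weights in the renewal equation are eventually equal to \<open>count_law q s m k\<close>,
  and all terms are dominated by the geometric series, so Tannery's theorem permits taking
  the limit inside the sum.
\<close>

lemma count_law_tendsto:
  fixes q :: real and \<theta> :: "nat \<Rightarrow> real"
  assumes q: "0 \<le> q" "q < 1" and \<theta>: "\<And>s. (\<lambda>n. nodes_left_prob q n s) \<longlonglongrightarrow> \<theta> s"
  shows "(\<lambda>s. \<theta> s * count_law q s m k) summable_on {m * k..}"
    and "(\<lambda>n. count_law q n m k) \<longlonglongrightarrow> (\<Sum>\<^sub>\<infinity>s\<in>{m * k..}. \<theta> s * count_law q s m k)"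
proof -
  have q': "q \<le> 1" using q by simp
  note law = count_law_bounds[OF q(1) q']
  have "\<exists>c. (\<forall>s. 0 \<le> c s \<and> c s \<le> 1) \<and> (\<forall>s. s + m < n \<longrightarrow> c s = count_law q s m k) \<and>
      (n \<ge> 1 \<longrightarrow> count_law q n m k = (\<Sum>s<n. nodes_left_prob q n s * c s))" for n
  proof (cases "n \<ge> 1")
    case True
    then show ?thesis by (rule count_law_renewal[OF q(1) q', of n m k]) blast
  qed (auto intro!: exI[of _ "\<lambda>_. 0"])
  then obtain c where c: "\<And>n s. 0 \<le> c n s" "\<And>n s. c n s \<le> 1"
    "\<And>n s. s + m < n \<Longrightarrow> c n s = count_law q s m k"
    "\<And>n. n \<ge> 1 \<Longrightarrow> count_law q n m k = (\<Sum>s<n. nodes_left_prob q n s * c n s)"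
    by metis
  let ?t = "\<lambda>s n. nodes_left_prob q n s * c n s"
  have bound: "norm (?t s n) \<le> q ^ s" for s n
    using nodes_left_prob_bounds[OF q(1) q', of n s] c(1,2)[of n s]
    by (simp add: abs_mult) (metis mult_left_le order_trans)
  have lim: "(?t s) \<longlonglongrightarrow> \<theta> s * count_law q s m k" for s
  proof (rule tendsto_mult[OF \<theta>], rule tendsto_eventually)
    show "\<forall>\<^sub>F n in sequentially. c n s = count_law q s m k"
      using eventually_gt_at_top[of "s + m"] by eventually_elim (rule c(3))
  qed
  have dominated: "\<forall>\<^sub>F (s, n) in sequentially \<times>\<^sub>F sequentially. norm (?t s n) \<le> q ^ s"
    using bound by (intro always_eventually) auto
  have sm: "summable (\<lambda>s. norm (\<theta> s * count_law q s m k))"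
    and T: "(\<lambda>n. \<Sum>s. ?t s n) \<longlonglongrightarrow> (\<Sum>s. \<theta> s * count_law q s m k)"
    using tannerys_theorem[OF lim dominated] q by (auto simp: summable_geometric)
  have infs: "(\<lambda>s. \<theta> s * count_law q s m k) summable_on UNIV"
    using sm by (rule norm_summable_imp_summable_on)
  then show "(\<lambda>s. \<theta> s * count_law q s m k) summable_on {m * k..}"
    by (rule summable_on_subset_banach) simp
  have "(\<lambda>n. \<Sum>s. ?t s n) \<longlonglongrightarrow> (\<Sum>\<^sub>\<infinity>s\<in>{m * k..}. \<theta> s * count_law q s m k)"
  proof -
    have "(\<Sum>s. \<theta> s * count_law q s m k) = (\<Sum>\<^sub>\<infinity>s. \<theta> s * count_law q s m k)"
      using sums_unique[OF has_sum_imp_sums[OF has_sum_infsum[OF infs]]] by simp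
    \<comment> \<open>The terms with \<open>s < m * k\<close> vanish: too few nodes for \<open>k\<close> components of size \<open>m\<close>.\<close>
    also have "\<dots> = (\<Sum>\<^sub>\<infinity>s\<in>{m * k..}. \<theta> s * count_law q s m k)"
      by (rule infsum_cong_neutral) (auto simp: count_law_eq_0)
    finally show ?thesis using T by simp
  qed
  moreover have "\<forall>\<^sub>F n in sequentially. (\<Sum>s. ?t s n) = count_law q n m k"
    using eventually_ge_at_top[of 1]
  proof eventually_elim
    case (elim n)
    have "(\<Sum>s. ?t s n) = (\<Sum>s<n. ?t s n)"
      by (rule suminf_finite) (auto simp: nodes_left_prob_def)
    with c(4)[OF elim] show ?case by simp
  qed
  ultimately show "(\<lambda>n. count_law q n m k) \<longlonglongrightarrow> (\<Sum>\<^sub>\<infinity>s\<in>{m * k..}. \<theta> s * count_law q s m k)"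
    by (rule Lim_transform_eventually)
qed

theorem theorem3:
  fixes l r :: real and m k :: nat
    and M :: "nat \<Rightarrow> 'a measure" and X :: "nat \<Rightarrow> nat \<Rightarrow> 'a \<Rightarrow> real"
  assumes "l > 0" and "r > 0" and "m \<ge> 1"
    and "\<And>n. exponential_sample l n (M n) (X n)"
  shows "(\<forall>s. convergent (\<lambda>n. last_node_prob (M n) (X n) r n (n - s))) \<and>
    (\<lambda>s. limit_last_node_prob M X r s * component_count_prob (M s) (X s) r s m k)
      summable_on {m * k..} \<and>
    (\<lambda>n. component_count_prob (M n) (X n) r n m k) \<longlonglongrightarrow>
      (\<Sum>\<^sub>\<infinity>s\<in>{m * k..}.
         limit_last_node_prob M X r s * component_count_prob (M s) (X s) r s m k)"
proof -
  define q where "q = exp (- (l * r))"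
  have q: "0 \<le> q" "q < 1" using assms(1,2) by (auto simp: q_def)
  have law: "component_count_prob (M n) (X n) r n m k = count_law q n m k" for n
    unfolding q_def by (rule component_count_prob_eq[OF assms(1,2,4)])
  define \<theta> where "\<theta> s = lim (\<lambda>n. nodes_left_prob q n s)" for s
  have \<theta>: "(\<lambda>n. nodes_left_prob q n s) \<longlonglongrightarrow> \<theta> s" for s
    using nodes_left_prob_convergent[of q s] q by (simp add: \<theta>_def convergent_LIMSEQ_iff)
  have last: "(\<lambda>n. last_node_prob (M n) (X n) r n (n - s)) \<longlonglongrightarrow> \<theta> s" for s
  proof (rule Lim_transform_eventually[OF \<theta>])
    show "\<forall>\<^sub>F n in sequentially. nodes_left_prob q n s = last_node_prob (M n) (X n) r n (n - s)"
      using eventually_gt_at_top[of s]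
      by eventually_elim (simp add: q_def last_node_prob_eq[OF assms(1,2,4)])
  qed
  have "limit_last_node_prob M X r s = \<theta> s" for s
    unfolding limit_last_node_prob_def using last by (rule limI)
  moreover have "convergent (\<lambda>n. last_node_prob (M n) (X n) r n (n - s))" for s
    using last by (rule convergentI)
  ultimately show ?thesis
    using count_law_tendsto[OF q \<theta>, of m k] by (simp add: law)
qed

end
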